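(* For $|q|<1$, $$\sum_{n=0}^{\infty} \Bigl( \sum_{d \mid 3n+2} d \Bigr) q^{n} = \frac{3\,(q^{3};q^{3})_{\infty}^{6}}{(q;q)_{\infty}^{2}},$$ where the inner sum runs over the positive divisors $d$ of $3n+2$.
   Context: For $|q|<1$, $(q;q)_\infty=\prod_{n=1}^{\infty}(1-q^n)$ and $(q^3;q^3)_\infty=\prod_{n=1}^\infty (1-q^{3n})$. *)

theory Defs
  imports "HOL-Analysis.Analysis"
begin

definition qpochhammer_inf :: "complex \<Rightarrow> complex \<Rightarrow> complex" where
  "qpochhammer_inf a q = (\<Prod>n. 1 - a * q ^ n)"

text \<open>\<^const>\<open>prodinf\<close> is unspecified for divergent products, so we record that the product
  converges for \<open>|q| < 1\<close>, and that \<open>a = q\<close> gives the product of \<open>1 - q ^ n\<close> over \<open>n \<ge> 1\<close>.\<close>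

lemma convergent_prod_qpochhammer_inf:
  fixes a q :: complex
  assumes "norm q < 1"
  shows "convergent_prod (\<lambda>n. 1 - a * q ^ n)"
proof -
  have "summable (\<lambda>n. norm a * norm q ^ n)"
    using assms by (intro summable_mult summable_geometric) auto
  then have "abs_convergent_prod (\<lambda>n. 1 - a * q ^ n)"
    by (subst abs_convergent_prod_conv_summable) (simp add: norm_mult norm_power)
  then show ?thesis
    by (rule abs_convergent_prod_imp_convergent_prod)
qed

lemma qpochhammer_inf_self: "qpochhammer_inf q q = (\<Prod>n. 1 - q ^ Suc n)"
  by (simp add: qpochhammer_inf_def)

end

theory Submission
  imports Defs
begin

text \<open>The divisors of \<open>3 * n + 2\<close> occur in pairs \<open>3 * a + 1\<close>, \<open>3 * b + 2\<close>, so the left-hand side is three times the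
  double series \<open>\<Sum>a b. (a + b + 1) * q ^ (3 * a * b + 2 * a + b)\<close>. Summing the part with weight \<open>b + 1\<close>
  over \<open>b\<close> and the part with weight \<open>a\<close> over \<open>a\<close> turns it into two series with terms
  \<open>q ^ (2 * a) / (1 - q ^ (3 * a + 1)) ^ 2\<close> and \<open>q ^ (4 * b + 2) / (1 - q ^ (3 * b + 2)) ^ 2\<close>. Together they
  form one series \<open>\<Sum>m. (p * w) ^ m / (w - p ^ m) ^ 2\<close> over all integers \<open>m\<close>, at \<open>p = q ^ 3\<close>, \<open>w = q\<close>.

  That series is the partial fraction expansion, in double poles, of \<open>(p; p)\<^sup>4 / \<theta>(w)\<^sup>2\<close>, where \<open>(x; p)\<close>
  is the infinite product of \<open>1 - x * p ^ n\<close> and \<open>\<theta>(w) = (w; p) (p / w; p)\<close>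
  (\<open>theta_quotient_partial_fractions\<close>). At \<open>w = q\<close>, \<open>p = q ^ 3\<close> the product \<open>\<theta>(w) (p; p)\<close> is \<open>(q; q)\<close>,
  so the value is \<open>(q ^ 3; q ^ 3)\<^sup>6 / (q; q)\<^sup>2\<close>, as required.

  The expansion itself has an elementary proof: it is the limit of a rational identity
  (\<open>finite_partial_fractions\<close>), which is Lagrange interpolation with nodes in geometric progression.
  Tannery's theorem justifies the limit. Distinct nodes require \<open>q \<noteq> 0\<close>. At \<open>q = 0\<close> the two
  sides are the divisor sum of 2 and the number 3.\<close>

section \<open>Lagrange interpolation\<close>

text \<open>The two sides are polynomials in \<open>t\<close> of degree less than \<open>card A\<close> that agree on \<open>A\<close>.\<close>

lemma lagrange_interpolation:
  fixes Q :: "'a::field poly"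
  assumes "finite A" "degree Q < card A"
  shows "poly Q t = (\<Sum>a\<in>A. poly Q a * (\<Prod>b\<in>A - {a}. (t - b) / (a - b)))"
proof -
  define L where "L = (\<Sum>a\<in>A. smult (poly Q a) (\<Prod>b\<in>A - {a}. smult (1 / (a - b)) [:- b, 1:]))"
  have poly_L: "poly L x = (\<Sum>a\<in>A. poly Q a * (\<Prod>b\<in>A - {a}. (x - b) / (a - b)))" for x
    by (simp add: L_def poly_sum poly_prod diff_divide_distrib)
  have "degree (\<Prod>b\<in>A - {a}. smult (1 / (a - b)) [:- b, 1:]) < card A" if "a \<in> A" for a
  proof -
    have "degree (\<Prod>b\<in>A - {a}. smult (1 / (a - b)) [:- b, 1:]) \<le>
        (\<Sum>b\<in>A - {a}. degree (smult (1 / (a - b)) [:- b, 1:]))"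
      using degree_prod_sum_le[of "A - {a}" "\<lambda>b. smult (1 / (a - b)) [:- b, 1:]"] assms(1)
      by (simp add: o_def)
    also have "\<dots> \<le> (\<Sum>b\<in>A - {a}. 1)"
      by (intro sum_mono) simp
    also have "\<dots> < card A"
      using that assms by (simp add: card_gt_0_iff)
    finally show ?thesis .
  qed
  then have "degree L < card A"
    unfolding L_def using assms by (intro degree_sum_less) (auto intro: le_less_trans[OF degree_smult_le])
  then have deg: "degree (Q - L) < card A"
    using assms by (intro degree_diff_less)
  have "poly L x = poly Q x" if "x \<in> A" for x
  proof -
    have "poly Q a * (\<Prod>b\<in>A - {a}. (x - b) / (a - b)) = (if a = x then poly Q x else 0)"
      if "a \<in> A" for a
      using \<open>x \<in> A\<close> assms(1) by (auto intro!: prod.neutral)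
    then show ?thesis
      unfolding poly_L using \<open>x \<in> A\<close> assms(1) by (simp cong: sum.cong)
  qed
  then have "A \<subseteq> {x. poly (Q - L) x = 0}"
    by auto
  then have "Q - L = 0"
    using deg card_mono[OF poly_roots_finite, of "Q - L" A] card_poly_roots_bound[of "Q - L"]
    by (metis leD le_trans)
  then show ?thesis
    using poly_L[of t] by simp
qed

section \<open>Partial fractions with nodes in geometric progression\<close>

definition qpochhammer :: "'a::comm_ring_1 \<Rightarrow> 'a \<Rightarrow> nat \<Rightarrow> 'a" where
  "qpochhammer x p n = (\<Prod>k<n. 1 - x * p ^ k)"

text \<open>The next two lemmas evaluate the two halves of \<open>\<Prod>i. p ^ j - w * p ^ i\<close>, cut at \<open>i = j\<close>.
  Each factor is divided by the larger of the two powers of \<open>p\<close> (the one with the smaller exponent),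
  which leaves \<open>1 - (p / w) * p ^ k\<close> below the cut and \<open>1 - w * p ^ k\<close> above it.\<close>

lemma prod_powers_below:
  fixes w p :: "'a::field"
  assumes "w \<noteq> 0"
  shows "(\<Prod>i<j. p ^ j - w * p ^ i) = (\<Prod>i<j. - w * p ^ i) * qpochhammer (p / w) p j"
proof -
  have "(\<Prod>i<j. p ^ j - w * p ^ i) = (\<Prod>i<j. (- w * p ^ i) * (1 - p / w * p ^ (j - Suc i)))"
    using assms by (intro prod.cong)
      (auto simp: field_simps simp flip: power_add power_Suc)
  also have "(\<Prod>i<j. 1 - p / w * p ^ (j - Suc i)) = qpochhammer (p / w) p j"
    unfolding qpochhammer_def by (rule prod.nat_diff_reindex)
  then have "(\<Prod>i<j. (- w * p ^ i) * (1 - p / w * p ^ (j - Suc i))) =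
     (\<Prod>i<j. - w * p ^ i) * qpochhammer (p / w) p j"
    by (simp only: prod.distrib)
  finally show ?thesis .
qed

lemma prod_powers_from:
  fixes w p :: "'a::field"
  assumes "j \<le> M"
  shows "(\<Prod>i\<in>{j..<M}. p ^ j - w * p ^ i) = p ^ (j * (M - j)) * qpochhammer w p (M - j)"
proof -
  have "(\<Prod>i\<in>{j..<M}. p ^ j - w * p ^ i) = (\<Prod>i<M - j. p ^ j * (1 - w * p ^ i))"
    using assms
    by (intro prod.reindex_bij_witness[of _ "\<lambda>i. i + j" "\<lambda>i. i - j"])
      (auto simp: algebra_simps simp flip: power_add)
  then show ?thesis
    by (simp add: prod.distrib qpochhammer_def power_mult)
qed

text \<open>This is the \<open>j\<close>-th coefficient in an interpolation formula with nodes \<open>p ^ i\<close>. The denominator is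
  the numerator at \<open>w = 1\<close> without its vanishing factor, so the powers of \<open>p\<close> of quadratic exponent cancel,
  and what remains tends to a ratio of infinite products.\<close>

lemma prod_powers_ratio:
  fixes w p :: "'a::field"
  assumes "w \<noteq> 0" "p \<noteq> 0" "j \<le> M"
  shows "(\<Prod>i\<le>M. p ^ j - w * p ^ i) / (\<Prod>i\<in>{..M} - {j}. p ^ j - p ^ i) =
    (p * w) ^ j * qpochhammer (p / w) p j * qpochhammer w p (Suc M - j) /
    (qpochhammer p p j * qpochhammer p p (M - j))"
proof -
  have "{..M} = {..<j} \<union> {j..<Suc M}"
    using assms by auto
  then have "(\<Prod>i\<le>M. p ^ j - w * p ^ i) =
      (\<Prod>i<j. p ^ j - w * p ^ i) * (\<Prod>i\<in>{j..<Suc M}. p ^ j - w * p ^ i)"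
    by (simp only:) (rule prod.union_disjoint; force)
  then have num: "(\<Prod>i\<le>M. p ^ j - w * p ^ i) =
      (\<Prod>i<j. - w * p ^ i) * qpochhammer (p / w) p j *
      (p ^ (j * (Suc M - j)) * qpochhammer w p (Suc M - j))"
    using assms prod_powers_below[of w p j] prod_powers_from[of j "Suc M" p w] by simp
  have "{..M} - {j} = {..<j} \<union> {Suc j..<Suc M}"
    using assms by auto
  then have "(\<Prod>i\<in>{..M} - {j}. p ^ j - p ^ i) =
      (\<Prod>i<j. p ^ j - p ^ i) * (\<Prod>i\<in>{Suc j..<Suc M}. p ^ j - p ^ i)"
    by (simp only:) (rule prod.union_disjoint; force)
  also have "(\<Prod>i\<in>{Suc j..<Suc M}. p ^ j - p ^ i) = (\<Prod>i\<in>{j..<M}. p ^ j - p * p ^ i)"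
    by (subst prod.shift_bounds_Suc_ivl) simp
  finally have den: "(\<Prod>i\<in>{..M} - {j}. p ^ j - p ^ i) =
      (\<Prod>i<j. - (p ^ i)) * qpochhammer p p j * (p ^ (j * (M - j)) * qpochhammer p p (M - j))"
    using assms prod_powers_below[of 1 p j] prod_powers_from[of j M p p] by simp
  have w: "(\<Prod>i<j. - w * p ^ i) = w ^ j * (\<Prod>i<j. - (p ^ i))"
    by (induction j) simp_all
  have p: "p ^ (j * (Suc M - j)) = p ^ j * p ^ (j * (M - j))"
    using assms by (simp add: Suc_diff_le flip: power_add)
  have cancel: "W * A * U * (P * B * V) / (A * X * (B * Y)) = (P * W) * U * V / (X * Y)"
    if "A \<noteq> 0" "B \<noteq> 0" for A B W U P V X Y :: 'a
    using that mult_divide_mult_cancel_left[of "A * B" "P * W * U * V" "X * Y"]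
    by (simp add: ac_simps)
  have "(\<Prod>i<j. - (p ^ i)) \<noteq> 0" "p ^ (j * (M - j)) \<noteq> 0"
    using assms by auto
  from cancel[OF this] show ?thesis
    unfolding num den w p power_mult_distrib .
qed

lemma power_inject_norm_less_1:
  fixes p :: complex
  assumes "p \<noteq> 0" "norm p < 1"
  shows "p ^ i = p ^ j \<longleftrightarrow> i = j"
proof
  assume "p ^ i = p ^ j"
  then have "norm p ^ i = norm p ^ j"
    by (metis norm_power)
  then show "i = j"
    using assms power_strict_decreasing_iff[of "norm p" i j] power_strict_decreasing_iff[of "norm p" j i]
    by (metis linorder_neqE_nat order_less_irrefl zero_less_norm_iff)
qed simp

lemma qpochhammer_Suc_left: "qpochhammer x p (Suc n) = (1 - x) * qpochhammer (x * p) p n"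
  unfolding qpochhammer_def by (subst prod.lessThan_Suc_shift) (simp add: mult.assoc)

lemma one_minus_mult_power_nonzero:
  fixes x p :: complex
  assumes "norm x < 1" "norm p < 1"
  shows "1 - x * p ^ n \<noteq> 0"
proof
  assume "1 - x * p ^ n = 0"
  then have "norm x * norm p ^ n = 1"
    by (metis eq_iff_diff_eq_0 norm_mult norm_one norm_power)
  moreover have "norm x * norm p ^ n \<le> norm x * 1"
    using assms by (intro mult_left_mono power_le_one) auto
  ultimately show False
    using assms by simp
qed

text \<open>Interpolate \<open>\<Prod>i \<in> {..2 * N} - {N}. x - w * p ^ i\<close>, as a polynomial in \<open>x\<close>, at the nodes
  \<open>p ^ j\<close>, \<open>j \<le> 2 * N\<close>, and evaluate it at \<open>x = w * p ^ N\<close>, the root that was left out.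
  The interpolation formula supplies one factor \<open>1 / (w * p ^ N - p ^ j)\<close>. Completing the product
  over \<open>i\<close> supplies a second one, hence the square in the denominator. The missing root is the middle one
  so that both tails of the sum over \<open>j - N\<close> become infinite as \<open>N\<close> grows.\<close>

lemma finite_partial_fractions:
  fixes u w p :: complex
  assumes u: "u \<noteq> 0" "norm u < 1" and w: "w \<noteq> 0" "norm w < 1" and p: "p = u * w"
  shows "qpochhammer p p N ^ 2 / (qpochhammer w p (Suc N) * qpochhammer u p N) =
    (\<Sum>j\<le>2 * N. p ^ N / w ^ N * (p * w) ^ j / (w * p ^ N - p ^ j) ^ 2 *
       (qpochhammer u p j * qpochhammer w p (Suc (2 * N) - j) /
        (qpochhammer p p j * qpochhammer p p (2 * N - j))))"
proof -
  have p0: "p \<noteq> 0" and p1: "norm p < 1"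
    using u w mult_strict_mono'[of "norm u" 1 "norm w" 1] by (auto simp: p norm_mult)
  have pw: "p / w = u"
    using w by (auto simp: p)
  have inj: "inj_on (\<lambda>j. p ^ j) J" for J
    using power_inject_norm_less_1[OF p0 p1] by (auto intro: inj_onI)
  have avoid: "w * p ^ N \<noteq> p ^ j" for j
  proof (cases "j \<le> N")
    case True
    then have "w * p ^ N - p ^ j = - (p ^ j) * (1 - w * p ^ (N - j))"
      by (simp add: algebra_simps flip: power_add)
    then show ?thesis
      using one_minus_mult_power_nonzero[OF w(2) p1, of "N - j"] p0 by auto
  next
    case False
    then obtain k where k: "j = Suc (N + k)"
      using less_imp_Suc_add not_le by metis
    have "w * p ^ N - p ^ j = w * p ^ N * (1 - u * p ^ k)"
      by (simp add: k power_add algebra_simps) (simp add: p)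
    then show ?thesis
      using one_minus_mult_power_nonzero[OF u(2) p1, of k] p0 w(1) by auto
  qed
  define M where "M = 2 * N"
  \<comment> \<open>\<open>R w\<close> gives the coefficients of the interpolation, while \<open>R (1 / w) N\<close> gives the value at the
    point of evaluation, because \<open>w * p ^ N - p ^ i = w * (p ^ N - 1 / w * p ^ i)\<close>.\<close>
  define R where "R = (\<lambda>x j. (\<Prod>i\<le>M. p ^ j - x * p ^ i) / (\<Prod>i\<in>{..M} - {j}. p ^ j - p ^ i))"
  define Q where "Q = (\<Prod>i\<in>{..M} - {N}. [:- (w * p ^ i), 1:])"
  have poly_Q: "poly Q x = (\<Prod>i\<in>{..M} - {N}. x - w * p ^ i)" for x
    by (simp add: Q_def poly_prod)
  have N: "N \<in> {..M}"
    by (simp add: M_def)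
  have card_nodes: "card ((\<lambda>j. p ^ j) ` {..M}) = Suc M"
    using inj by (simp add: card_image)
  have "degree Q \<le> (\<Sum>i\<in>{..M} - {N}. degree [:- (w * p ^ i), 1:])"
    unfolding Q_def by (rule order.trans[OF degree_prod_sum_le]) (simp_all add: o_def)
  also have "\<dots> = M"
    using N by simp
  finally have "degree Q < card ((\<lambda>j. p ^ j) ` {..M})"
    by (simp add: card_nodes)
  from lagrange_interpolation[OF _ this, of "w * p ^ N"]
  have "poly Q (w * p ^ N) = (\<Sum>j\<le>M. poly Q (p ^ j) *
      (\<Prod>b\<in>(\<lambda>j. p ^ j) ` {..M} - {p ^ j}. (w * p ^ N - b) / (p ^ j - b)))"
    using inj by (simp add: sum.reindex)
  also have "\<dots> = (\<Sum>j\<le>M. poly Q (p ^ j) * (\<Prod>i\<in>{..M} - {j}. (w * p ^ N - p ^ i) / (p ^ j - p ^ i)))"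
  proof (intro sum.cong refl)
    fix j assume "j \<in> {..M}"
    then have "(\<lambda>j. p ^ j) ` {..M} - {p ^ j} = (\<lambda>j. p ^ j) ` ({..M} - {j})"
      using power_inject_norm_less_1[OF p0 p1] by auto
    then show "poly Q (p ^ j) *
      (\<Prod>b\<in>(\<lambda>j. p ^ j) ` {..M} - {p ^ j}. (w * p ^ N - b) / (p ^ j - b)) =
      poly Q (p ^ j) * (\<Prod>i\<in>{..M} - {j}. (w * p ^ N - p ^ i) / (p ^ j - p ^ i))"
      using inj by (simp add: prod.reindex)
  qed
  also have "\<dots> = (\<Sum>j\<le>M. - (\<Prod>i\<le>M. w * p ^ N - p ^ i) * R w j / (w * p ^ N - p ^ j) ^ 2)"
  proof (intro sum.cong refl)
    fix j assume j: "j \<in> {..M}"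
    have 1: "(\<Prod>i\<le>M. p ^ j - w * p ^ i) = (p ^ j - w * p ^ N) * poly Q (p ^ j)"
      unfolding poly_Q using N by (intro prod.remove) auto
    have 2: "(\<Prod>i\<le>M. w * p ^ N - p ^ i) =
        (w * p ^ N - p ^ j) * (\<Prod>i\<in>{..M} - {j}. w * p ^ N - p ^ i)"
      using j by (intro prod.remove) auto
    have 3: "w * p ^ N - p ^ j \<noteq> 0"
      using avoid[of j] by simp
    have cancel: "y * (P / D) = - (d * P) * (e * y / D) / d ^ 2"
      if "d \<noteq> 0" "e = - d" for y P D d e :: complex
      unfolding that(2) using that(1) by (cases "D = 0") (auto simp: field_simps power2_eq_square)
    show "poly Q (p ^ j) * (\<Prod>i\<in>{..M} - {j}. (w * p ^ N - p ^ i) / (p ^ j - p ^ i)) =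
       - (\<Prod>i\<le>M. w * p ^ N - p ^ i) * R w j / (w * p ^ N - p ^ j) ^ 2"
      unfolding R_def 1 2 prod_dividef by (rule cancel[OF 3]) simp
  qed
  finally have eq1: "poly Q (w * p ^ N) / (\<Prod>i\<le>M. w * p ^ N - p ^ i) =
      - (\<Sum>j\<le>M. R w j / (w * p ^ N - p ^ j) ^ 2)"
    using avoid by (simp add: sum_negf sum_distrib_left field_simps)
  have "poly Q (w * p ^ N) = w ^ M * (\<Prod>i\<in>{..M} - {N}. p ^ N - p ^ i)"
    using N by (simp add: poly_Q prod.distrib flip: right_diff_distrib)
  moreover have "(\<Prod>i\<le>M. w * p ^ N - p ^ i) = (\<Prod>i\<le>M. w * (p ^ N - 1 / w * p ^ i))"
    using w(1) by (simp add: right_diff_distrib)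
  then have "(\<Prod>i\<le>M. w * p ^ N - p ^ i) = w ^ Suc M * (\<Prod>i\<le>M. p ^ N - 1 / w * p ^ i)"
    by (simp only: prod.distrib) simp
  ultimately have "poly Q (w * p ^ N) / (\<Prod>i\<le>M. w * p ^ N - p ^ i) = 1 / (w * R (1 / w) N)"
    using w(1) by (simp add: R_def)
  also have "w * R (1 / w) N = - (p ^ N / w ^ N *
      (qpochhammer w p (Suc N) * qpochhammer u p N) / qpochhammer p p N ^ 2)"
  proof -
    have "Suc M - N = Suc N" "M - N = N"
      by (simp_all add: M_def)
    then have "R (1 / w) N = (p / w) ^ N * qpochhammer (p * w) p N * qpochhammer (1 / w) p (Suc N) /
        qpochhammer p p N ^ 2"
      unfolding R_def using prod_powers_ratio[of "1 / w" p N M] w(1) p0 N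
      by (simp add: power2_eq_square)
    moreover have "w * (a * b * ((1 - 1 / w) * c) / d) = - (a * ((1 - w) * b * c) / d)"
      for a b c d :: complex
      using w(1) by (cases "d = 0") (simp_all add: field_simps)
    moreover have "1 / w * p = u"
      using pw by simp
    ultimately show ?thesis
      by (simp only: qpochhammer_Suc_left mult.commute[of p w] power_divide)
  qed
  finally have "qpochhammer p p N ^ 2 / (qpochhammer w p (Suc N) * qpochhammer u p N) * (w ^ N / p ^ N) =
      (\<Sum>j\<le>M. R w j / (w * p ^ N - p ^ j) ^ 2)"
    using eq1 by (simp add: field_simps)
  then have "qpochhammer p p N ^ 2 / (qpochhammer w p (Suc N) * qpochhammer u p N) =
      p ^ N / w ^ N * (\<Sum>j\<le>M. R w j / (w * p ^ N - p ^ j) ^ 2)"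
    using p0 w(1) by (simp flip: \<open>_ = (\<Sum>j\<le>M. R w j / (w * p ^ N - p ^ j) ^ 2)\<close>)
  also have "\<dots> = (\<Sum>j\<le>M. p ^ N / w ^ N * (p * w) ^ j / (w * p ^ N - p ^ j) ^ 2 *
       (qpochhammer u p j * qpochhammer w p (Suc M - j) /
        (qpochhammer p p j * qpochhammer p p (M - j))))"
    unfolding sum_distrib_left R_def
    by (intro sum.cong refl) (simp add: prod_powers_ratio w(1) p0 pw ac_simps)
  finally show ?thesis
    by (simp add: M_def)
qed

section \<open>The limit of the partial fraction expansion\<close>

lemma qpochhammer_LIMSEQ:
  fixes x p :: complex
  assumes "norm p < 1"
  shows "qpochhammer x p \<longlonglongrightarrow> qpochhammer_inf x p"
  using has_prod_imp_tendsto'[OF convergent_prod_has_prod[OF convergent_prod_qpochhammer_inf[OF assms]]]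
  unfolding qpochhammer_def qpochhammer_inf_def by simp

lemma qpochhammer_inf_nonzero:
  fixes x p :: complex
  assumes "norm x < 1" "norm p < 1"
  shows "qpochhammer_inf x p \<noteq> 0"
  unfolding qpochhammer_inf_def
  using assms by (intro prodinf_nonzero convergent_prod_qpochhammer_inf one_minus_mult_power_nonzero)

lemma qpochhammer_bounds:
  fixes x p :: complex
  assumes "norm x < 1" "norm p < 1"
  obtains C where "C \<ge> 1" "\<And>n. norm (qpochhammer x p n) \<le> C" "\<And>n. norm (inverse (qpochhammer x p n)) \<le> C"
proof -
  have "qpochhammer x p \<longlonglongrightarrow> qpochhammer_inf x p"
    using assms(2) by (rule qpochhammer_LIMSEQ)
  then have "Bseq (qpochhammer x p)" "Bseq (\<lambda>n. inverse (qpochhammer x p n))"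
    using tendsto_inverse[OF _ qpochhammer_inf_nonzero[OF assms]] convergentI convergent_imp_Bseq
    by blast+
  then obtain C1 C2 where "\<And>n. norm (qpochhammer x p n) \<le> C1"
    "\<And>n. norm (inverse (qpochhammer x p n)) \<le> C2"
    unfolding Bseq_def by blast
  then show thesis
    by (intro that[of "max 1 (max C1 C2)"]) (auto simp: le_max_iff_disj)
qed

text \<open>Finite products \<open>qpochhammer x p n\<close> and their inverses are bounded in \<open>n\<close>, so a constant multiple
  of \<open>norm (f k)\<close> dominates the summands and Tannery's theorem applies. The lengths \<open>a\<close>, \<open>b\<close>, \<open>c\<close>, \<open>d\<close> may
  tend to infinity at a rate that depends on \<open>k\<close>.\<close>

lemma tannery_qpochhammer_quotient:
  fixes u w p :: complex
  assumes u: "norm u < 1" and w: "norm w < 1" and p: "norm p < 1"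
    and f: "summable (\<lambda>k. norm (f k))"
    and lims: "\<And>k. filterlim (\<lambda>N. a N k) at_top sequentially"
      "\<And>k. filterlim (\<lambda>N. b N k) at_top sequentially"
      "\<And>k. filterlim (\<lambda>N. c N k) at_top sequentially"
      "\<And>k. filterlim (\<lambda>N. d N k) at_top sequentially"
    and m: "filterlim m at_top sequentially"
  shows "(\<lambda>N. \<Sum>k<m N. f k * (qpochhammer u p (a N k) * qpochhammer w p (b N k) /
      (qpochhammer p p (c N k) * qpochhammer p p (d N k)))) \<longlonglongrightarrow>
    (\<Sum>k. f k) * (qpochhammer_inf u p * qpochhammer_inf w p / qpochhammer_inf p p ^ 2)"
proof -
  define g where "g = (\<lambda>N k. qpochhammer u p (a N k) * qpochhammer w p (b N k) /
      (qpochhammer p p (c N k) * qpochhammer p p (d N k)))"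
  define L where "L = qpochhammer_inf u p * qpochhammer_inf w p / qpochhammer_inf p p ^ 2"
  obtain A where A: "A \<ge> 1" "\<And>n. norm (qpochhammer u p n) \<le> A"
    using qpochhammer_bounds[OF u p] by metis
  obtain B where B: "B \<ge> 1" "\<And>n. norm (qpochhammer w p n) \<le> B"
    using qpochhammer_bounds[OF w p] by metis
  obtain C where C: "C \<ge> 1" "\<And>n. norm (inverse (qpochhammer p p n)) \<le> C"
    using qpochhammer_bounds[OF p p] by metis
  have g_bound: "norm (g N k) \<le> A * B * (C * C)" for N k
    unfolding g_def divide_inverse inverse_mult_distrib norm_mult
    using A B C by (intro mult_mono) auto
  have g_lim: "(\<lambda>N. g N k) \<longlonglongrightarrow> L" for k
    unfolding g_def L_def power2_eq_square
    using lims[of k] qpochhammer_inf_nonzero[OF p p]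
    by (intro tendsto_intros filterlim_compose[OF qpochhammer_LIMSEQ[OF p]]) auto
  have "(\<lambda>N. \<Sum>k. if k < m N then f k * g N k else 0) \<longlonglongrightarrow> (\<Sum>k. f k * L)"
  proof (intro tannerys_theorem[THEN conjunct2, THEN conjunct2])
    fix k
    have "\<forall>\<^sub>F N in sequentially. Suc k \<le> m N"
      using m unfolding filterlim_at_top by blast
    then show "(\<lambda>N. if k < m N then f k * g N k else 0) \<longlonglongrightarrow> f k * L"
      by (intro Lim_transform_eventually[OF tendsto_mult[OF tendsto_const g_lim[of k]]])
        (auto elim!: eventually_mono simp: Suc_le_eq)
  next
    show "\<forall>\<^sub>F (k, N) in sequentially \<times>\<^sub>F sequentially.
        norm (if k < m N then f k * g N k else 0) \<le> norm (f k) * (A * B * (C * C))"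
      using A(1) B(1) C(1) g_bound by (intro always_eventually) (auto simp: norm_mult mult_left_mono)
  next
    show "summable (\<lambda>k. norm (f k) * (A * B * (C * C)))"
      using f by (rule summable_mult2)
  qed simp
  moreover have "(\<Sum>k. if k < m N then f k * g N k else 0) = (\<Sum>k<m N. f k * g N k)" for N
    by (subst suminf_finite[of "{..<m N}"]) auto
  ultimately show ?thesis
    using suminf_mult2[OF summable_norm_cancel[OF f], of L] by (simp add: g_def L_def)
qed

lemma summable_norm_geometric_over_square:
  fixes r x p :: complex
  assumes "norm r < 1" "norm x < 1" "norm p < 1"
  shows "summable (\<lambda>k. norm (r ^ k / (1 - x * p ^ k) ^ 2))"
proof -
  have "(\<lambda>k. (1 - x * p ^ k) ^ 2) \<longlonglongrightarrow> (1 - x * 0) ^ 2"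
    using assms by (intro tendsto_intros LIMSEQ_power_zero)
  then have "(\<lambda>k. inverse ((1 - x * p ^ k) ^ 2)) \<longlonglongrightarrow> inverse 1"
    by (intro tendsto_inverse) auto
  then have "Bseq (\<lambda>k. inverse ((1 - x * p ^ k) ^ 2))"
    using convergentI convergent_imp_Bseq by blast
  then obtain B where B: "\<And>k. norm (inverse ((1 - x * p ^ k) ^ 2)) \<le> B"
    unfolding Bseq_def by blast
  show ?thesis
  proof (rule summable_comparison_test'[of "\<lambda>k. norm r ^ k * B"])
    show "summable (\<lambda>k. norm r ^ k * B)"
      using assms by (intro summable_mult2 summable_geometric) auto
    show "norm (norm (r ^ k / (1 - x * p ^ k) ^ 2)) \<le> norm r ^ k * B" for k
      unfolding divide_inverse norm_mult norm_power[of r] real_norm_def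
      using B[of k] by (simp add: norm_mult norm_power abs_mult mult_left_mono)
  qed
qed

text \<open>The case \<open>N \<rightarrow> \<infinity>\<close> of the finite expansion. With \<open>\<theta>\<close> for the product of \<open>qpochhammer_inf w p\<close> and
  \<open>qpochhammer_inf (p / w) p\<close>, it is the bilateral expansion of \<open>(p; p)\<^sup>4 / \<theta>(w)\<^sup>2\<close> into double poles
  \<open>(p * w) ^ m / (w - p ^ m) ^ 2\<close>, where \<open>m\<close> is an integer. The terms with \<open>m \<le> 0\<close> form the first series
  below and those with \<open>m \<ge> 1\<close> the second.\<close>

theorem theta_quotient_partial_fractions:
  fixes u w p :: complex
  assumes u: "u \<noteq> 0" "norm u < 1" and w: "w \<noteq> 0" "norm w < 1" and p: "p = u * w"
  shows "(\<Sum>k. u ^ k / (1 - w * p ^ k) ^ 2) + u * (\<Sum>k. (p * w) ^ k / (1 - u * p ^ k) ^ 2) =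
    qpochhammer_inf p p ^ 4 / (qpochhammer_inf u p * qpochhammer_inf w p) ^ 2"
proof -
  have p0: "p \<noteq> 0" and p1: "norm p < 1"
    using u w mult_strict_mono'[of "norm u" 1 "norm w" 1] by (auto simp: p norm_mult)
  have pw1: "norm (p * w) < 1"
    using p1 w mult_strict_mono'[of "norm p" 1 "norm w" 1] by (auto simp: norm_mult)
  define F where "F = (\<lambda>N j. p ^ N / w ^ N * (p * w) ^ j / (w * p ^ N - p ^ j) ^ 2 *
       (qpochhammer u p j * qpochhammer w p (Suc (2 * N) - j) /
        (qpochhammer p p j * qpochhammer p p (2 * N - j))))"
  define f1 where "f1 = (\<lambda>k. u ^ k / (1 - w * p ^ k) ^ 2)"
  define f2 where "f2 = (\<lambda>k. (p * w) ^ k / (1 - u * p ^ k) ^ 2)"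
  define D where "D = qpochhammer_inf u p * qpochhammer_inf w p"
  \<comment> \<open>The index \<open>j = N + m\<close> belongs to the pole \<open>p ^ m\<close>: \<open>lower\<close> treats \<open>m = - k\<close> and \<open>upper\<close> treats
    \<open>m = k + 1\<close>.\<close>
  have lower: "F N (N - k) = f1 k * (qpochhammer u p (N - k) * qpochhammer w p (Suc (N + k)) /
      (qpochhammer p p (N - k) * qpochhammer p p (N + k)))" if "k \<le> N" for N k
  proof -
    obtain j where N: "N = j + k"
      using le_Suc_ex[OF \<open>k \<le> N\<close>] by (auto simp: add.commute)
    have "(w * p ^ (j + k) - p ^ j) ^ 2 = (p ^ j * (1 - w * p ^ k)) ^ 2"
      by (simp add: power2_eq_square power_add algebra_simps)
    moreover have "u ^ k = p ^ k / w ^ k"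
      using w(1) by (simp add: p power_mult_distrib)
    ultimately have "p ^ N / w ^ N * (p * w) ^ j / (w * p ^ N - p ^ j) ^ 2 = f1 k"
      using p0 w(1) unfolding N f1_def
      by (simp add: power_mult_distrib power_add power2_eq_square[of "p ^ j"])
    moreover have "N - k = j" "Suc (2 * N) - j = Suc (N + k)" "2 * N - j = N + k"
      using N by auto
    ultimately show ?thesis
      by (simp only: F_def)
  qed
  have upw: "u = p / w"
    using w(1) by (simp add: p)
  have upper: "F N (Suc (N + k)) = u * (f2 k * (qpochhammer u p (Suc (N + k)) * qpochhammer w p (N - k) /
      (qpochhammer p p (Suc (N + k)) * qpochhammer p p (N - Suc k))))" if "k < N" for N k
  proof -
    have "w * p ^ N - p ^ Suc (N + k) = w * p ^ N * (1 - u * p ^ k)"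
      by (simp add: power_add algebra_simps) (simp add: p)
    then have "p ^ N / w ^ N * (p * w) ^ Suc (N + k) / (w * p ^ N - p ^ Suc (N + k)) ^ 2 = u * f2 k"
      using p0 w(1) upw unfolding f2_def
      by (simp add: power_mult_distrib power_add power2_eq_square)
    moreover have "Suc (2 * N) - Suc (N + k) = N - k" "2 * N - Suc (N + k) = N - Suc k"
      by auto
    ultimately show ?thesis
      by (simp only: F_def mult.assoc)
  qed
  have split: "(\<Sum>j\<le>2 * N. F N j) = (\<Sum>k<Suc N. F N (N - k)) + (\<Sum>k<N. F N (Suc (N + k)))" for N
  proof -
    have "{..2 * N} = {..N} \<union> {Suc N..2 * N}"
      by auto
    then have "(\<Sum>j\<le>2 * N. F N j) = (\<Sum>j\<le>N. F N j) + (\<Sum>j\<in>{Suc N..2 * N}. F N j)"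
      by (simp only:) (rule sum.union_disjoint; force)
    also have "(\<Sum>j\<le>N. F N j) = (\<Sum>k<Suc N. F N (N - k))"
      by (rule sum.reindex_bij_witness[of _ "\<lambda>k. N - k" "\<lambda>k. N - k"]) auto
    also have "(\<Sum>j\<in>{Suc N..2 * N}. F N j) = (\<Sum>k<N. F N (Suc (N + k)))"
      by (rule sum.reindex_bij_witness[of _ "\<lambda>k. Suc (N + k)" "\<lambda>k. k - Suc N"]) auto
    finally show ?thesis .
  qed
  have shift: "filterlim (\<lambda>N. N - k) at_top sequentially" "filterlim (\<lambda>N. N + k) at_top sequentially"
    "filterlim (\<lambda>N. Suc (N + k)) at_top sequentially" for k
    by (rule filterlim_minus_const_nat_at_top filterlim_add_const_nat_at_top
        filterlim_compose[OF filterlim_Suc filterlim_add_const_nat_at_top])+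
  have "(\<lambda>N. \<Sum>k<Suc N. f1 k * (qpochhammer u p (N - k) * qpochhammer w p (Suc (N + k)) /
      (qpochhammer p p (N - k) * qpochhammer p p (N + k)))) \<longlonglongrightarrow>
      suminf f1 * (qpochhammer_inf u p * qpochhammer_inf w p / qpochhammer_inf p p ^ 2)"
    unfolding f1_def
    by (intro tannery_qpochhammer_quotient summable_norm_geometric_over_square u w p1 shift filterlim_Suc)
  then have lim1: "(\<lambda>N. \<Sum>k<Suc N. F N (N - k)) \<longlonglongrightarrow> suminf f1 * (D / qpochhammer_inf p p ^ 2)"
    by (simp add: lower D_def del: sum.lessThan_Suc)
  have "(\<lambda>N. \<Sum>k<N. f2 k * (qpochhammer u p (Suc (N + k)) * qpochhammer w p (N - k) /
      (qpochhammer p p (Suc (N + k)) * qpochhammer p p (N - Suc k)))) \<longlonglongrightarrow>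
      suminf f2 * (qpochhammer_inf u p * qpochhammer_inf w p / qpochhammer_inf p p ^ 2)"
    unfolding f2_def
    by (intro tannery_qpochhammer_quotient summable_norm_geometric_over_square u w p1 pw1 shift filterlim_ident)
  from tendsto_mult_left[OF this, of u]
  have lim2: "(\<lambda>N. \<Sum>k<N. F N (Suc (N + k))) \<longlonglongrightarrow> u * (suminf f2 * (D / qpochhammer_inf p p ^ 2))"
    by (simp add: upper D_def sum_distrib_left)
  have "(\<lambda>N. \<Sum>j\<le>2 * N. F N j) \<longlonglongrightarrow>
      suminf f1 * (D / qpochhammer_inf p p ^ 2) + u * (suminf f2 * (D / qpochhammer_inf p p ^ 2))"
    unfolding split by (intro tendsto_add lim1 lim2)
  moreover have D0: "D \<noteq> 0" and P0: "qpochhammer_inf p p \<noteq> 0"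
    using qpochhammer_inf_nonzero u w p1 by (auto simp: D_def)
  have "(\<lambda>N. qpochhammer p p N ^ 2 / (qpochhammer w p (Suc N) * qpochhammer u p N)) \<longlonglongrightarrow>
      qpochhammer_inf p p ^ 2 / (qpochhammer_inf w p * qpochhammer_inf u p)"
    using D0 by (intro tendsto_intros qpochhammer_LIMSEQ LIMSEQ_Suc p1) (auto simp: D_def)
  then have "(\<lambda>N. \<Sum>j\<le>2 * N. F N j) \<longlonglongrightarrow> qpochhammer_inf p p ^ 2 / D"
    unfolding F_def finite_partial_fractions[OF u w p] by (simp add: D_def mult.commute)
  ultimately have "suminf f1 * (D / qpochhammer_inf p p ^ 2) + u * (suminf f2 * (D / qpochhammer_inf p p ^ 2)) =
      qpochhammer_inf p p ^ 2 / D"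
    using LIMSEQ_unique by blast
  then have "(suminf f1 + u * suminf f2) * (D / qpochhammer_inf p p ^ 2) = qpochhammer_inf p p ^ 2 / D"
    by (simp only: distrib_right mult.assoc)
  then have "(suminf f1 + u * suminf f2) * (D / qpochhammer_inf p p ^ 2) * (qpochhammer_inf p p ^ 2 / D) =
      qpochhammer_inf p p ^ 2 / D * (qpochhammer_inf p p ^ 2 / D)"
    by (simp only:)
  then have "suminf f1 + u * suminf f2 = qpochhammer_inf p p ^ 4 / D ^ 2"
    using D0 P0 by (simp add: power2_eq_square power4_eq_xxxx)
  then show ?thesis
    by (simp add: f1_def f2_def D_def)
qed

section \<open>Euler's product modulo 3\<close>

text \<open>The exponents in the product for \<open>qpochhammer_inf q q\<close> are sorted by their residue modulo 3.\<close>

lemma qpochhammer_inf_trisection: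
  fixes q :: complex
  assumes "norm q < 1"
  shows "qpochhammer_inf q q =
    qpochhammer_inf q (q ^ 3) * qpochhammer_inf (q ^ 2) (q ^ 3) * qpochhammer_inf (q ^ 3) (q ^ 3)"
proof -
  have q3: "norm (q ^ 3) < 1"
    using assms by (simp add: norm_power power_less_one_iff)
  have finite: "qpochhammer q q (3 * n) =
      qpochhammer q (q ^ 3) n * qpochhammer (q ^ 2) (q ^ 3) n * qpochhammer (q ^ 3) (q ^ 3) n" for n
  proof (induction n)
    case (Suc n)
    have "qpochhammer q q (Suc (Suc (Suc (3 * n)))) = qpochhammer q q (3 * n) *
        ((1 - q * q ^ (3 * n)) * (1 - q ^ 2 * q ^ (3 * n)) * (1 - q ^ 3 * q ^ (3 * n)))"
      by (simp add: qpochhammer_def power2_eq_square power3_eq_cube mult.assoc)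
    also have "Suc (Suc (Suc (3 * n))) = 3 * Suc n"
      by simp
    finally have "qpochhammer q q (3 * Suc n) = qpochhammer q q (3 * n) *
        ((1 - q * q ^ (3 * n)) * (1 - q ^ 2 * q ^ (3 * n)) * (1 - q ^ 3 * q ^ (3 * n)))" .
    then show ?case
      unfolding Suc.IH by (simp add: qpochhammer_def mult_ac flip: power_mult)
  qed (simp add: qpochhammer_def)
  have "filterlim (\<lambda>n::nat. 3 * n) at_top sequentially"
    by (rule filterlim_subseq) (simp add: strict_mono_def)
  then have "(\<lambda>n. qpochhammer q q (3 * n)) \<longlonglongrightarrow> qpochhammer_inf q q"
    by (rule filterlim_compose[OF qpochhammer_LIMSEQ[OF assms]])
  moreover have "(\<lambda>n. qpochhammer q q (3 * n)) \<longlonglongrightarrow>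
    qpochhammer_inf q (q ^ 3) * qpochhammer_inf (q ^ 2) (q ^ 3) * qpochhammer_inf (q ^ 3) (q ^ 3)"
    unfolding finite by (intro tendsto_mult qpochhammer_LIMSEQ q3)
  ultimately show ?thesis
    by (rule LIMSEQ_unique)
qed

section \<open>Divisors of numbers congruent to 2 modulo 3\<close>

text \<open>The number \<open>n\<close> for which \<open>3 * n + 2\<close> has the factorisation \<open>(3 * a + 1) * (3 * b + 2)\<close>.\<close>

definition factor_exponent :: "nat \<Rightarrow> nat \<Rightarrow> nat" where
  "factor_exponent a b = 3 * a * b + 2 * a + b"

lemma factor_exponent_eq_iff: "factor_exponent a b = n \<longleftrightarrow> (3 * a + 1) * (3 * b + 2) = 3 * n + 2"
  by (auto simp: factor_exponent_def algebra_simps)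

lemma finite_factor_exponent_fibre: "finite {(a, b). factor_exponent a b = n}"
proof (rule finite_subset)
  show "{(a, b). factor_exponent a b = n} \<subseteq> {..n} \<times> {..n}"
    by (auto simp: factor_exponent_def)
qed simp

lemma mod_3_of_factor:
  fixes d e n :: nat
  assumes "d * e = 3 * n + 2"
  shows "d mod 3 = 1 \<and> e mod 3 = 2 \<or> d mod 3 = 2 \<and> e mod 3 = 1"
proof -
  have "(d mod 3) * (e mod 3) mod 3 = (3 * n + 2) mod 3"
    using assms by (simp only: mod_mult_eq)
  also have "\<dots> = 2"
    by presburger
  finally have "(d mod 3) * (e mod 3) mod 3 = 2" .
  moreover have "d mod 3 = 0 \<or> d mod 3 = 1 \<or> d mod 3 = 2" "e mod 3 = 0 \<or> e mod 3 = 1 \<or> e mod 3 = 2"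
    by presburger+
  ultimately show ?thesis
    by auto
qed

text \<open>In each factorisation of \<open>3 * n + 2\<close> one factor is \<open>3 * a + 1\<close> and the other is \<open>3 * b + 2\<close>. Hence
  the divisors come in pairs with sum \<open>3 * (a + b + 1)\<close>.\<close>

lemma divisor_sum_3n_plus_2:
  "(\<Sum>d | d dvd 3 * n + 2. d) = (\<Sum>(a, b) | factor_exponent a b = n. 3 * (a + b + 1))"
proof -
  define N where "N = 3 * n + 2"
  define S where "S = {(a, b). factor_exponent a b = n}"
  have S_iff: "(a, b) \<in> S \<longleftrightarrow> (3 * a + 1) * (3 * b + 2) = N" for a b
    by (simp add: S_def N_def factor_exponent_eq_iff)
  have N0: "N > 0"
    by (simp add: N_def)
  have residues: "d mod 3 = 1 \<and> (N div d) mod 3 = 2 \<or> d mod 3 = 2 \<and> (N div d) mod 3 = 1" if "d dvd N" for d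
    using that by (intro mod_3_of_factor[of _ _ n]) (simp add: N_def)
  have decomp: "m = 3 * (m div 3) + r" if "m mod 3 = r" for m r :: nat
    using that by presburger
  have 1: "(\<Sum>(a, b)\<in>S. 3 * a + 1) = (\<Sum>d | d dvd N \<and> d mod 3 = 1. d)"
  proof (rule sum.reindex_bij_witness[of S "\<lambda>d. (d div 3, N div d div 3)" "\<lambda>(a, b). 3 * a + 1"])
    fix ab assume "ab \<in> S"
    then obtain a b where ab: "ab = (a, b)" "N = (3 * a + 1) * (3 * b + 2)"
      using S_iff by (metis surj_pair)
    moreover have "(3 * a + 1) div 3 = a" "(3 * b + 2) div 3 = b"
      by presburger+
    moreover have "N div (3 * a + 1) = 3 * b + 2"
      unfolding ab(2) by (rule nonzero_mult_div_cancel_left) simp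
    ultimately show "((case ab of (a, b) \<Rightarrow> 3 * a + 1) div 3, N div (case ab of (a, b) \<Rightarrow> 3 * a + 1) div 3) = ab"
      by (simp add: ab(1))
    have "(3 * a + 1) dvd N" "(3 * a + 1) mod 3 = 1"
      unfolding ab(2) by (rule dvd_triv_left) presburger
    then show "(case ab of (a, b) \<Rightarrow> 3 * a + 1) \<in> {d. d dvd N \<and> d mod 3 = 1}"
      by (simp add: ab(1))
  next
    fix d assume d: "d \<in> {d. d dvd N \<and> d mod 3 = 1}"
    then have mods: "d mod 3 = 1" "N div d mod 3 = 2"
      using residues[of d] by auto
    have "(3 * (d div 3) + 1) * (3 * (N div d div 3) + 2) = d * (N div d)"
      by (simp only: decomp[OF mods(1), symmetric] decomp[OF mods(2), symmetric])
    then have "(3 * (d div 3) + 1) * (3 * (N div d div 3) + 2) = N"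
      using d by simp
    then show "(d div 3, N div d div 3) \<in> S"
      by (simp only: S_iff)
    show "(case (d div 3, N div d div 3) of (a, b) \<Rightarrow> 3 * a + 1) = d"
      using decomp[OF mods(1)] by simp
  qed auto
  have 2: "(\<Sum>(a, b)\<in>S. 3 * b + 2) = (\<Sum>d | d dvd N \<and> d mod 3 = 2. d)"
  proof (rule sum.reindex_bij_witness[of S "\<lambda>d. (N div d div 3, d div 3)" "\<lambda>(a, b). 3 * b + 2"])
    fix ab assume "ab \<in> S"
    then obtain a b where ab: "ab = (a, b)" "N = (3 * a + 1) * (3 * b + 2)"
      using S_iff by (metis surj_pair)
    moreover have "(3 * a + 1) div 3 = a" "(3 * b + 2) div 3 = b"
      by presburger+
    moreover have "N div (3 * b + 2) = 3 * a + 1"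
      unfolding ab(2) by (rule nonzero_mult_div_cancel_right) simp
    ultimately show "(N div (case ab of (a, b) \<Rightarrow> 3 * b + 2) div 3, (case ab of (a, b) \<Rightarrow> 3 * b + 2) div 3) = ab"
      by (simp add: ab(1))
    have "(3 * b + 2) dvd N" "(3 * b + 2) mod 3 = 2"
      unfolding ab(2) by (rule dvd_triv_right) presburger
    then show "(case ab of (a, b) \<Rightarrow> 3 * b + 2) \<in> {d. d dvd N \<and> d mod 3 = 2}"
      by (simp add: ab(1))
  next
    fix d assume d: "d \<in> {d. d dvd N \<and> d mod 3 = 2}"
    then have mods: "d mod 3 = 2" "N div d mod 3 = 1"
      using residues[of d] by auto
    have "(3 * (N div d div 3) + 1) * (3 * (d div 3) + 2) = N div d * d"
      by (simp only: decomp[OF mods(1), symmetric] decomp[OF mods(2), symmetric])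
    then have "(3 * (N div d div 3) + 1) * (3 * (d div 3) + 2) = N"
      using d by simp
    then show "(N div d div 3, d div 3) \<in> S"
      by (simp only: S_iff)
    show "(case (N div d div 3, d div 3) of (a, b) \<Rightarrow> 3 * b + 2) = d"
      using decomp[OF mods(1)] by simp
  qed auto
  have fin: "finite {d. d dvd N \<and> d mod 3 = r}" for r
    by (rule finite_subset[OF _ finite_divisors_nat[OF N0]]) auto
  have disj: "{d. d dvd N \<and> d mod 3 = 1} \<inter> {d. d dvd N \<and> d mod 3 = 2} = {}"
    by auto
  have split: "{d. d dvd N} = {d. d dvd N \<and> d mod 3 = 1} \<union> {d. d dvd N \<and> d mod 3 = 2}"
    using residues by auto
  have "(\<Sum>d | d dvd N. d) = (\<Sum>d | d dvd N \<and> d mod 3 = 1. d) + (\<Sum>d | d dvd N \<and> d mod 3 = 2. d)"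
    unfolding split by (rule sum.union_disjoint[OF fin fin disj])
  also have "\<dots> = (\<Sum>(a, b)\<in>S. 3 * (a + b + 1))"
    unfolding 1[symmetric] 2[symmetric] sum.distrib[symmetric] by (intro sum.cong) auto
  finally show ?thesis
    by (simp only: N_def S_def)
qed

section \<open>The Lambert series\<close>

lemma geometric_deriv_sums':
  fixes z :: "'a::{real_normed_field,banach}"
  assumes "norm z < 1"
  shows "(\<lambda>n. of_nat n * z ^ n) sums (z / (1 - z) ^ 2)"
proof -
  have "(\<lambda>n. z * (of_nat (Suc n) * z ^ n)) sums (z * (1 / (1 - z) ^ 2))"
    by (intro sums_mult geometric_deriv_sums assms)
  then have "(\<lambda>n. of_nat (Suc n) * z ^ Suc n) sums (z / (1 - z) ^ 2)"
    by (simp add: mult_ac)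
  then show ?thesis
    by (subst (asm) sums_Suc_iff) simp
qed

text \<open>This turns an iterated sum into an unordered double sum, whose terms can then be regrouped at will.
  A product bound is enough here, since \<open>factor_exponent a b \<ge> a + b\<close>.\<close>

lemma has_sum_rows:
  fixes f :: "nat \<Rightarrow> nat \<Rightarrow> complex" and g h :: "nat \<Rightarrow> real"
  assumes bound: "\<And>a b. norm (f a b) \<le> g a * h b"
    and "summable g" "summable h" and nonneg: "\<And>a. g a \<ge> 0" "\<And>b. h b \<ge> 0"
    and rows: "\<And>a. f a sums r a"
  shows "((\<lambda>(a, b). f a b) has_sum (\<Sum>a. r a)) UNIV"
proof -
  have gh: "g summable_on UNIV" "h summable_on UNIV"
    using assms by (simp_all add: summable_on_UNIV_nonneg_real_iff)
  have "(\<lambda>(a, b). g a * h b) summable_on Sigma UNIV (\<lambda>_. UNIV)"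
  proof (rule summable_on_SigmaI)
    show "((\<lambda>b. case (a, b) of (a, b) \<Rightarrow> g a * h b) has_sum g a * infsum h UNIV) UNIV" for a
      using has_sum_cmult_right[OF has_sum_infsum[OF gh(2)]] by simp
    show "(\<lambda>a. g a * infsum h UNIV) summable_on UNIV"
      using gh(1) by (rule summable_on_cmult_left)
  qed (use nonneg in simp)
  then have "(\<lambda>(a, b). g a * h b) summable_on UNIV"
    by simp
  then have "(\<lambda>x. norm (case x of (a, b) \<Rightarrow> f a b)) summable_on UNIV"
    by (rule Infinite_Sum.abs_summable_on_comparison_test'[of "\<lambda>(a, b). g a * h b"]) (use bound in auto)
  then have summ: "(\<lambda>(a, b). f a b) summable_on Sigma UNIV (\<lambda>_. UNIV)"
    by (simp add: abs_summable_summable)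
  have "(f a has_sum r a) UNIV" for a
  proof -
    have "f a summable_on UNIV"
      using summable_on_SigmaD1[OF summ] by simp
    then show ?thesis
      using rows[of a] has_sum_imp_sums sums_unique2 has_sum_infsum by metis
  qed
  then have "(r has_sum infsum (\<lambda>(a, b). f a b) (Sigma UNIV (\<lambda>_. UNIV))) UNIV"
    by (intro has_sum_SigmaD[OF has_sum_infsum[OF summ]]) simp
  then have "infsum (\<lambda>(a, b). f a b) (Sigma UNIV (\<lambda>_. UNIV)) = (\<Sum>a. r a)"
    using has_sum_imp_sums sums_unique by metis
  then show ?thesis
    using has_sum_infsum[OF summ] by simp
qed

theorem theorem1p1:
  fixes q :: complex
  assumes "norm q < 1"
  shows "(\<lambda>n. of_nat (\<Sum>d | d dvd 3 * n + 2. d) * q ^ n) sums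
    (3 * qpochhammer_inf (q ^ 3) (q ^ 3) ^ 6 / qpochhammer_inf q q ^ 2)"
proof (cases "q = 0")
  case True
  have "{d. d dvd (2::nat)} = {1, 2}"
    using prime_nat_iff two_is_prime_nat by auto
  then have "(\<Sum>d | d dvd 3 * 0 + (2::nat). d) = 3"
    by (simp only: mult_zero_right add_0) simp
  then have "(\<lambda>n. of_nat (\<Sum>d | d dvd 3 * n + 2. d) * q ^ n) sums of_nat 3"
    using powser_sums_zero[of "\<lambda>n. of_nat (\<Sum>d | d dvd 3 * n + 2. d) :: complex"]
    by (simp only: True)
  then show ?thesis
    by (simp add: qpochhammer_inf_def True)
next
  case False
  define Q where "Q = norm q"
  have Q: "0 \<le> Q" "Q < 1"
    using assms by (simp_all add: Q_def)
  have q_pow: "norm (q ^ k) < 1" if "k > 0" for k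
    using assms that by (simp add: norm_power power_less_one_iff)
  have sum_Q: "summable (\<lambda>n. Q ^ n)" "summable (\<lambda>n. real n * Q ^ n)"
    using Q sums_summable[OF geometric_deriv_sums'[of Q]] by (simp_all add: summable_geometric)
  \<comment> \<open>The weight \<open>a + b + 1\<close> is split into \<open>b + 1\<close> and \<open>a\<close>. Summed over \<open>b\<close> and over \<open>a\<close> respectively,
    the two parts give the two series of \<open>theta_quotient_partial_fractions\<close>
    at \<open>u = q ^ 2\<close>, \<open>w = q\<close>.\<close>
  define f1 where "f1 = (\<lambda>a b. of_nat (Suc b) * q ^ factor_exponent a b)"
  define f2 where "f2 = (\<lambda>b a. of_nat a * q ^ factor_exponent a b)"
  have le: "Q ^ m \<le> Q ^ n" if "n \<le> m" for m n
    using Q that by (intro power_decreasing) auto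
  have S1: "((\<lambda>(a, b). f1 a b) has_sum (\<Sum>a. (q ^ 2) ^ a / (1 - q * (q ^ 3) ^ a) ^ 2)) UNIV"
  proof (rule has_sum_rows)
    show "norm (f1 a b) \<le> Q ^ a * (real b * Q ^ b + Q ^ b)" for a b
    proof -
      have "norm (f1 a b) = (real b + 1) * Q ^ factor_exponent a b"
        by (simp add: f1_def norm_mult norm_power Q_def add.commute flip: of_nat_Suc)
      also have "\<dots> \<le> (real b + 1) * Q ^ (a + b)"
        by (intro mult_left_mono le) (auto simp: factor_exponent_def)
      finally show ?thesis
        by (simp add: power_add algebra_simps)
    qed
    show "f1 a sums ((q ^ 2) ^ a / (1 - q * (q ^ 3) ^ a) ^ 2)" for a
    proof -
      have "(\<lambda>b. (q ^ 2) ^ a * (of_nat (Suc b) * (q ^ (3 * a + 1)) ^ b)) sums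
          ((q ^ 2) ^ a * (1 / (1 - q ^ (3 * a + 1)) ^ 2))"
        by (intro sums_mult geometric_deriv_sums q_pow) simp
      moreover have "(q ^ 2) ^ a * (of_nat (Suc b) * (q ^ (3 * a + 1)) ^ b) = f1 a b" for b
      proof -
        have "factor_exponent a b = 2 * a + (3 * a + 1) * b"
          by (simp add: factor_exponent_def algebra_simps)
        then have "q ^ factor_exponent a b = (q ^ 2) ^ a * (q ^ (3 * a + 1)) ^ b"
          by (simp only: power_add power_mult)
        then show ?thesis
          by (simp only: f1_def mult_ac)
      qed
      ultimately show ?thesis
        by (simp add: power_add mult.commute flip: power_mult)
    qed
  qed (use Q sum_Q in \<open>auto intro!: summable_add\<close>)
  have S2: "((\<lambda>(b, a). f2 b a) has_sum
      (\<Sum>b. q ^ 2 * ((q ^ 3 * q) ^ b / (1 - q ^ 2 * (q ^ 3) ^ b) ^ 2))) UNIV"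
  proof (rule has_sum_rows)
    show "norm (f2 b a) \<le> Q ^ b * (real a * Q ^ a)" for a b
    proof -
      have "norm (f2 b a) = real a * Q ^ factor_exponent a b"
        by (simp add: f2_def norm_mult norm_power Q_def)
      also have "\<dots> \<le> real a * Q ^ (a + b)"
        by (intro mult_left_mono le) (auto simp: factor_exponent_def)
      finally show ?thesis
        by (simp add: power_add algebra_simps)
    qed
    show "f2 b sums (q ^ 2 * ((q ^ 3 * q) ^ b / (1 - q ^ 2 * (q ^ 3) ^ b) ^ 2))" for b
    proof -
      have "(\<lambda>a. q ^ b * (of_nat a * (q ^ (3 * b + 2)) ^ a)) sums
          (q ^ b * (q ^ (3 * b + 2) / (1 - q ^ (3 * b + 2)) ^ 2))"
        by (intro sums_mult geometric_deriv_sums' q_pow) simp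
      moreover have "q ^ b * (of_nat a * (q ^ (3 * b + 2)) ^ a) = f2 b a" for a
      proof -
        have "factor_exponent a b = b + (3 * b + 2) * a"
          by (simp add: factor_exponent_def algebra_simps)
        then have "q ^ factor_exponent a b = q ^ b * (q ^ (3 * b + 2)) ^ a"
          by (simp only: power_add power_mult)
        then show ?thesis
          by (simp only: f2_def mult_ac)
      qed
      moreover have "q ^ b * (q ^ (3 * b + 2) / (1 - q ^ (3 * b + 2)) ^ 2) =
          q ^ 2 * ((q ^ 3 * q) ^ b / (1 - q ^ 2 * (q ^ 3) ^ b) ^ 2)"
      proof -
        have "q ^ (3 * b + 2) = q ^ 2 * (q ^ 3) ^ b"
          by (simp add: power_add power_mult power2_eq_square)
        then show ?thesis
          by (simp only: power_mult_distrib) (simp add: mult_ac)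
      qed
      ultimately show ?thesis
        by (simp only:)
    qed
  qed (use Q sum_Q in auto)
  define P where "P = qpochhammer_inf (q ^ 3) (q ^ 3)"
  define T where "T = qpochhammer_inf (q ^ 2) (q ^ 3) * qpochhammer_inf q (q ^ 3)"
  have P0: "P \<noteq> 0"
    unfolding P_def by (intro qpochhammer_inf_nonzero q_pow) auto
  have summ: "summable (\<lambda>b. (q ^ 3 * q) ^ b / (1 - q ^ 2 * (q ^ 3) ^ b) ^ 2)"
    using q_pow[of 4] q_pow[of 2] q_pow[of 3]
    by (intro summable_norm_cancel[OF summable_norm_geometric_over_square])
      (simp_all add: power3_eq_cube power2_eq_square power4_eq_xxxx mult_ac)
  have "(\<Sum>a. (q ^ 2) ^ a / (1 - q * (q ^ 3) ^ a) ^ 2) +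
      (\<Sum>b. q ^ 2 * ((q ^ 3 * q) ^ b / (1 - q ^ 2 * (q ^ 3) ^ b) ^ 2)) = P ^ 4 / T ^ 2"
    unfolding P_def T_def suminf_mult[OF summ]
    using theta_quotient_partial_fractions[of "q ^ 2" q "q ^ 3"] False assms q_pow[of 2]
    by (simp add: power3_eq_cube power2_eq_square)
  also have "P ^ 4 / T ^ 2 = P ^ 6 / qpochhammer_inf q q ^ 2"
  proof -
    have "qpochhammer_inf q q = T * P"
      unfolding qpochhammer_inf_trisection[OF assms] T_def P_def by (simp only: mult_ac)
    moreover have "P ^ 6 = P ^ 4 * P ^ 2"
      by (simp flip: power_add)
    moreover have "P ^ 4 * P ^ 2 / (T ^ 2 * P ^ 2) = P ^ 4 / T ^ 2"
      using P0 by (intro nonzero_mult_divide_mult_cancel_right) simp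
    ultimately show ?thesis
      by (simp only: power_mult_distrib)
  qed
  finally have total: "(\<Sum>a. (q ^ 2) ^ a / (1 - q * (q ^ 3) ^ a) ^ 2) +
      (\<Sum>b. q ^ 2 * ((q ^ 3 * q) ^ b / (1 - q ^ 2 * (q ^ 3) ^ b) ^ 2)) =
      P ^ 6 / qpochhammer_inf q q ^ 2" .
  have S2': "((\<lambda>(a, b). f2 b a) has_sum
      (\<Sum>b. q ^ 2 * ((q ^ 3 * q) ^ b / (1 - q ^ 2 * (q ^ 3) ^ b) ^ 2))) UNIV"
    using S2 by (subst has_sum_reindex_bij_witness[of UNIV prod.swap prod.swap UNIV "\<lambda>(b, a). f2 b a"]) auto
  define t where "t = (\<lambda>(a, b). of_nat (3 * (a + b + 1)) * q ^ factor_exponent a b)"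
  have "((\<lambda>ab. 3 * ((\<lambda>(a, b). f1 a b) ab + (\<lambda>(a, b). f2 b a) ab)) has_sum
      3 * (P ^ 6 / qpochhammer_inf q q ^ 2)) UNIV"
    unfolding total[symmetric] by (intro has_sum_cmult_right has_sum_add S1 S2')
  moreover have "(\<lambda>ab. 3 * ((\<lambda>(a, b). f1 a b) ab + (\<lambda>(a, b). f2 b a) ab)) = t"
    by (auto simp: t_def f1_def f2_def fun_eq_iff algebra_simps)
  ultimately have "(t has_sum 3 * (P ^ 6 / qpochhammer_inf q q ^ 2)) UNIV"
    by simp
  \<comment> \<open>Collect the terms with equal exponent of \<open>q\<close>.\<close>
  moreover have "((\<lambda>(n, ab). t ab) has_sum s) (Sigma UNIV (\<lambda>n. {(a, b). factor_exponent a b = n}))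
      \<longleftrightarrow> (t has_sum s) UNIV" for s
    by (rule has_sum_reindex_bij_witness[of _ "\<lambda>(a, b). (factor_exponent a b, (a, b))" snd]) auto
  ultimately have "((\<lambda>(n, ab). t ab) has_sum 3 * (P ^ 6 / qpochhammer_inf q q ^ 2))
      (Sigma UNIV (\<lambda>n. {(a, b). factor_exponent a b = n}))"
    by simp
  then have "((\<lambda>n. of_nat (\<Sum>d | d dvd 3 * n + 2. d) * q ^ n) has_sum
      3 * (P ^ 6 / qpochhammer_inf q q ^ 2)) UNIV"
  proof (rule has_sum_SigmaD)
    fix n :: nat
    let ?S = "{(a, b). factor_exponent a b = n}"
    have "(\<Sum>ab\<in>?S. t ab) = (\<Sum>(a, b)\<in>?S. of_nat (3 * (a + b + 1)) * q ^ n)"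
      by (intro sum.cong) (auto simp: t_def)
    also have "\<dots> = of_nat (\<Sum>d | d dvd 3 * n + 2. d) * q ^ n"
      unfolding divisor_sum_3n_plus_2 by (simp add: sum_distrib_right case_prod_unfold)
    finally show "((\<lambda>ab. case (n, ab) of (n, ab) \<Rightarrow> t ab) has_sum
        of_nat (\<Sum>d | d dvd 3 * n + 2. d) * q ^ n) ?S"
      using has_sum_finite[OF finite_factor_exponent_fibre, of t n] by simp
  qed
  from has_sum_imp_sums[OF this] show ?thesis
    by (simp add: P_def)
qed

end
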